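(* Let $G=(V_l\cup V_r,E)$ be a complete bipartite graph with $N=N_l+N_r$ vertices, $N_l=|V_l|\ge 1$, $N_r=|V_r|\ge 1$. There is a quantum walk-based search algorithm on $G$ that does not need to know the number of marked vertices and has the following guarantee. For every $\epsilon\in(0,1]$ and every positive integer $h$ with $$h\ \ge\ \ln\!\Big(\frac{2}{\sqrt{\epsilon}}\Big)\max\big(\sqrt{N_l},\sqrt{N_r}\big)+1,$$ there exist real parameters $\alpha_1,\dots,\alpha_h,\beta_1,\dots,\beta_h$, chosen independently of the set of marked vertices, such that for every nonempty set $M\subseteq V_l\cup V_r$ of marked vertices the $h$-step quantum walk search with these parameters outputs a marked vertex with probability $P_h\ge 1-\epsilon$.
   Context: Complete bipartite graph: vertex set $V=V_l\sqcup V_r$, every vertex of $V_l$ is joined to every vertex of $V_r$, and there are no other edges. For a vertex $u$, $\deg(u)$ denotes the set of neighbours of $u$ and $d_u=|\deg(u)|$. Quantum walk search with parameters. The Hilbert space is spanned by the orthonormal basis $\{|uv\rangle : u,v\in V\}$ (first register: position $u$; second register: coin value $v$). Let $M\subseteq V$ be the set of marked vertices. For real $\alpha,\beta$ set: - $S|uv\rangle=|vu\rangle$ (flip-flop shift); - $C(\alpha)=\sum_{u}|u\rangle\langle u|\otimes\big[(1-e^{-i\alpha})|s_u\rangle\langle s_u|-I\big]$, where $|s_u\rangle=\frac{1}{\sqrt{d_u}}\sum_{v\in\deg(u)}|v\rangle$; - $Q(\beta)|uv\rangle=e^{i\beta}|uv\rangle$ if $u\in M$, and $Q(\beta)|uv\rangle=|uv\rangle$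 if $u\notin M$; - $U(\alpha,\beta)=S\,C(\alpha)\,Q(\beta)$ (one search step). The $h$-step algorithm prepares $|\Psi_0\rangle=\frac{1}{\sqrt{2N_lN_r}}\sum_{u\in V}|u\rangle\otimes\sum_{v\in\deg(u)}|v\rangle$, applies $U(\alpha_1,\beta_1),\dots,U(\alpha_h,\beta_h)$ in turn to obtain $|\Psi_h\rangle=U(\alpha_h,\beta_h)\cdots U(\alpha_1,\beta_1)|\Psi_0\rangle$, then measures the first register in the computational basis; if the resulting vertex is not marked, it measures the second register; it outputs the last measurement result. Its success probability (the probability of outputting a marked vertex) is $$P_h=\sum_{(u,v)\in V\times V:\ u\in M\text{ or }v\in M}\big|\langle uv|\Psi_h\rangle\big|^2 .$$ *)

theory Defs
  imports "HOL-Analysis.Analysis"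
begin

section \<open>Complete bipartite graphs\<close>

text \<open>A graph is given by its adjacency relation on a finite type, whose universe is the vertex set.\<close>

definition complete_bipartite :: "('v \<Rightarrow> 'v \<Rightarrow> bool) \<Rightarrow> 'v set \<Rightarrow> 'v set \<Rightarrow> bool" where
  "complete_bipartite E Vl Vr \<longleftrightarrow>
     Vl \<union> Vr = UNIV \<and> Vl \<inter> Vr = {} \<and>
     (\<forall>u v. E u v \<longleftrightarrow> (u \<in> Vl \<and> v \<in> Vr) \<or> (u \<in> Vr \<and> v \<in> Vl))"

definition nbrs :: "('v \<Rightarrow> 'v \<Rightarrow> bool) \<Rightarrow> 'v \<Rightarrow> 'v set" where
  "nbrs E u = {v. E u v}"

definition deg :: "('v \<Rightarrow> 'v \<Rightarrow> bool) \<Rightarrow> 'v \<Rightarrow> nat" where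
  "deg E u = card (nbrs E u)"

section \<open>Kets, outer products and tensor products\<close>

definition ket :: "'i::finite \<Rightarrow> complex ^ 'i" where
  "ket i = axis i 1"

definition outer :: "complex ^ 'i \<Rightarrow> complex ^ 'j \<Rightarrow> complex ^ 'j ^ 'i" where
  "outer x y = (\<chi> i j. x $ i * cnj (y $ j))"

definition scale_mat :: "complex \<Rightarrow> complex ^ 'j ^ 'i \<Rightarrow> complex ^ 'j ^ 'i" (infixr "*\<^sub>m" 75) where
  "c *\<^sub>m A = (\<chi> i j. c * A $ i $ j)"

definition tensor_vec :: "complex ^ 'i \<Rightarrow> complex ^ 'j \<Rightarrow> complex ^ ('i \<times> 'j)" where
  "tensor_vec x y = (\<chi> p. x $ fst p * y $ snd p)"

definition tensor_mat ::
  "complex ^ 'i ^ 'i \<Rightarrow> complex ^ 'j ^ 'j \<Rightarrow> complex ^ ('i \<times> 'j) ^ ('i \<times> 'j)" where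
  "tensor_mat A B = (\<chi> p q. A $ fst p $ fst q * B $ snd p $ snd q)"

section \<open>The quantum walk search\<close>

text \<open>The component of a state at \<open>(u, v)\<close> is its amplitude at position \<open>u\<close> with coin value \<open>v\<close>;
  the basis contains all pairs of vertices, adjacent or not.\<close>

type_synonym 'v state = "complex ^ ('v \<times> 'v)"
type_synonym 'v operator = "complex ^ ('v \<times> 'v) ^ ('v \<times> 'v)"

definition shift :: "'v::finite operator" where
  "shift = (\<Sum>u\<in>UNIV. \<Sum>v\<in>UNIV. outer (ket (v, u)) (ket (u, v)))"

definition coin_state :: "('v::finite \<Rightarrow> 'v \<Rightarrow> bool) \<Rightarrow> 'v \<Rightarrow> complex ^ 'v" where
  "coin_state E u = complex_of_real (1 / sqrt (real (deg E u))) *s (\<Sum>v\<in>nbrs E u. ket v)"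

definition coin :: "('v::finite \<Rightarrow> 'v \<Rightarrow> bool) \<Rightarrow> real \<Rightarrow> 'v operator" where
  "coin E \<alpha> = (\<Sum>u\<in>UNIV. tensor_mat (outer (ket u) (ket u))
     ((1 - exp (- (\<i> * complex_of_real \<alpha>))) *\<^sub>m outer (coin_state E u) (coin_state E u) - mat 1))"

definition query :: "'v::finite set \<Rightarrow> real \<Rightarrow> 'v operator" where
  "query M \<beta> = (\<Sum>u\<in>UNIV. \<Sum>v\<in>UNIV.
     (if u \<in> M then exp (\<i> * complex_of_real \<beta>) else 1) *\<^sub>m outer (ket (u, v)) (ket (u, v)))"

definition step :: "('v::finite \<Rightarrow> 'v \<Rightarrow> bool) \<Rightarrow> 'v set \<Rightarrow> real \<Rightarrow> real \<Rightarrow> 'v operator" where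
  "step E M \<alpha> \<beta> = shift ** coin E \<alpha> ** query M \<beta>"

definition init_state :: "('v::finite \<Rightarrow> 'v \<Rightarrow> bool) \<Rightarrow> 'v set \<Rightarrow> 'v set \<Rightarrow> 'v state" where
  "init_state E Vl Vr =
     complex_of_real (1 / sqrt (2 * real (card Vl) * real (card Vr))) *s
       (\<Sum>u\<in>UNIV. tensor_vec (ket u) (\<Sum>v\<in>nbrs E u. ket v))"

text \<open>The parameter sequences are indexed from 1: \<open>h\<close> steps use exactly the values at \<open>1, \<dots>, h\<close>.\<close>

primrec walk_state ::
  "('v::finite \<Rightarrow> 'v \<Rightarrow> bool) \<Rightarrow> 'v set \<Rightarrow> 'v set \<Rightarrow> 'v set \<Rightarrow>
   (nat \<Rightarrow> real) \<Rightarrow> (nat \<Rightarrow> real) \<Rightarrow> nat \<Rightarrow> 'v state" where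
  "walk_state E Vl Vr M \<alpha> \<beta> 0 = init_state E Vl Vr"
| "walk_state E Vl Vr M \<alpha> \<beta> (Suc k) =
     step E M (\<alpha> (Suc k)) (\<beta> (Suc k)) *v walk_state E Vl Vr M \<alpha> \<beta> k"

text \<open>The position is measured first and the coin only if that position is unmarked, and the last
  result is output; so a marked vertex is output exactly on the outcomes \<open>(u, v)\<close> with \<open>u\<close> or
  \<open>v\<close> marked.\<close>

definition success_prob ::
  "('v::finite \<Rightarrow> 'v \<Rightarrow> bool) \<Rightarrow> 'v set \<Rightarrow> 'v set \<Rightarrow> 'v set \<Rightarrow>
   (nat \<Rightarrow> real) \<Rightarrow> (nat \<Rightarrow> real) \<Rightarrow> nat \<Rightarrow> real" where
  "success_prob E Vl Vr M \<alpha> \<beta> h =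
     (\<Sum>(u, v) | u \<in> M \<or> v \<in> M. (cmod (walk_state E Vl Vr M \<alpha> \<beta> h $ (u, v)))\<^sup>2)"

section \<open>Action of shift and query on the basis\<close>

lemma outer_mult_vec: "outer x y *v z = (\<Sum>j\<in>UNIV. cnj (y $ j) * z $ j) *s x"
  by (simp add: vec_eq_iff outer_def matrix_vector_mult_def sum_distrib_right sum_distrib_left ac_simps)

lemma outer_ket_mult_ket: "outer x (ket p) *v ket q = (if p = q then x else 0)"
proof -
  have "(\<Sum>j\<in>UNIV. cnj (ket p $ j) * ket q $ j) =
      (\<Sum>j\<in>UNIV. if j = p then if p = q then 1 else 0 else 0)"
    by (intro sum.cong) (auto simp: ket_def axis_def)
  then have "(\<Sum>j\<in>UNIV. cnj (ket p $ j) * ket q $ j) = (if p = q then 1 else 0)"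
    by (simp only: sum.delta finite UNIV_I if_True)
  then show ?thesis
    by (simp add: outer_mult_vec vec_eq_iff)
qed

lemma sum_mult_vec: "(\<Sum>i\<in>A. F i :: complex ^ 'n ^ 'm) *v x = (\<Sum>i\<in>A. F i *v x)"
  by (induction A rule: infinite_finite_induct) (auto simp: matrix_vector_mult_add_rdistrib)

lemma scale_mult_vec: "(c *\<^sub>m A) *v (x :: complex ^ 'n) = c *s (A *v x)"
  by (simp add: vec_eq_iff scale_mat_def matrix_vector_mult_def sum_distrib_left ac_simps)

lemma shift_ket: "shift *v ket (u, v) = ket (v, u)"
proof -
  have "shift *v ket (u, v) =
      (\<Sum>a\<in>UNIV. \<Sum>b\<in>UNIV. if a = u then if b = v then ket (b, a) else 0 else 0)"
    unfolding shift_def sum_mult_vec outer_ket_mult_ket by (intro sum.cong) auto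
  also have "\<dots> = (\<Sum>a\<in>UNIV. if a = u then ket (v, a) else 0)"
    by (intro sum.cong) auto
  finally show ?thesis by simp
qed

lemma query_ket:
  "query M \<beta> *v ket (u, v) = (if u \<in> M then exp (\<i> * complex_of_real \<beta>) else 1) *s ket (u, v)"
    (is "_ = ?c u *s _")
proof -
  have "query M \<beta> *v ket (u, v) =
      (\<Sum>a\<in>UNIV. \<Sum>b\<in>UNIV. if a = u then if b = v then ?c a *s ket (a, b) else 0 else 0)"
    unfolding query_def sum_mult_vec scale_mult_vec outer_ket_mult_ket by (intro sum.cong) auto
  also have "\<dots> = (\<Sum>a\<in>UNIV. if a = u then ?c a *s ket (a, v) else 0)"
    by (intro sum.cong) auto
  finally show ?thesis by simp
qed

end

theory Submission
  imports Defs "HOL-Computational_Algebra.Fundamental_Theorem_Algebra"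
begin

text \<open>
  Started on either side, the walk keeps position and coin in a product state, and a step swaps the
  two factors after marking the position factor and diffusing the coin factor. So each side evolves
  separately, in the plane spanned by its uniform marked and unmarked vectors, by alternating
  generalised Grover rotations. One of the two factors uses \<open>\<beta>\<close> at odd and \<open>\<alpha>\<close> at even times, the
  other the opposite, so their phases can be chosen independently, and both get to make at least
  \<open>(h - 2) / 2\<close> iterations.

  With \<open>y\<close> the unmarked fraction of a side, \<open>n\<close> iterations give amplitudes that are polynomials \<open>Q\<close>
  (marked) and \<open>P\<close> (unmarked) in \<open>y\<close> of degree at most \<open>n\<close> with \<open>y |P|\<^sup>2 + (1 - y) |Q|\<^sup>2 = 1\<close>.
  Conversely every such pair arises from suitable phases: a last rotation that lowers both degrees
  can always be split off. The required pair has \<open>\<surd>y P(y) = \<delta> T\<^sub>L(\<kappa> \<surd>y)\<close>, where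
  \<open>\<delta> = \<surd>\<epsilon>\<close>, \<open>T\<^sub>L\<close> is the Chebyshev polynomial of degree \<open>L = 2 n + 1\<close> and \<open>T\<^sub>L(\<kappa>) = 1 / \<delta>\<close>; then
  \<open>(1 - y |P|\<^sup>2) / (1 - y)\<close> is a nonnegative real polynomial, hence of the form \<open>|Q|\<^sup>2\<close>.
\<close>

section \<open>Nonnegative real polynomials\<close>

lemma poly_nonneg_closure_right:
  fixes p :: "real poly"
  assumes "\<And>x. x > r \<Longrightarrow> poly p x \<ge> 0"
  shows "poly p r \<ge> 0"
proof (rule tendsto_lowerbound)
  show "(poly p \<longlongrightarrow> poly p r) (at_right r)"
    by (intro tendsto_intros)
  show "eventually (\<lambda>x. 0 \<le> poly p x) (at_right r)"
    by (rule eventually_at_rightI[of r "r + 1"]) (use assms in auto)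
qed auto

lemma poly_nonpos_closure_left:
  fixes p :: "real poly"
  assumes "\<And>x. x < r \<Longrightarrow> poly p x \<le> 0"
  shows "poly p r \<le> 0"
proof (rule tendsto_upperbound)
  show "(poly p \<longlongrightarrow> poly p r) (at_left r)"
    by (intro tendsto_intros)
  show "eventually (\<lambda>x. poly p x \<le> 0) (at_left r)"
    by (rule eventually_at_leftI[of "r - 1"]) (use assms in auto)
qed auto

lemma poly_map_poly_of_real:
  "poly (map_poly complex_of_real p) (complex_of_real x) = complex_of_real (poly p x)"
  by (induction p) (auto simp: map_poly_pCons)

text \<open>Identities that involve complex conjugation hold only at real arguments; infinitely many
  points still determine a polynomial, so such identities may be compared coefficient by
  coefficient.\<close>

lemma poly_eqI_of_real:
  fixes p q :: "complex poly"
  assumes "\<And>y. poly p (complex_of_real y) = poly q (complex_of_real y)"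
  shows "p = q"
proof (rule ccontr)
  assume "p \<noteq> q"
  then have "finite {x. poly (p - q) x = 0}" by (intro poly_roots_finite) simp
  moreover have "range complex_of_real \<subseteq> {x. poly (p - q) x = 0}"
    using assms by auto
  moreover have "infinite (range complex_of_real)"
    by (simp add: finite_image_iff inj_of_real infinite_UNIV_char_0)
  ultimately show False using finite_subset by blast
qed

text \<open>Take any complex root \<open>z\<close>. If it is real, the quotient by x - z is
  nonpositive to its left and nonnegative to its right, so the root is at least double. Otherwise
  the remainder modulo (x - z)(x - cnj z) has real coefficients, degree below 2 and the non-real
  root \<open>z\<close>, hence is zero.\<close>

lemma quadratic_factor_of_nonneg_poly:
  fixes p :: "real poly"
  assumes nonneg: "\<And>x. poly p x \<ge> 0" and deg: "degree p > 0"
  obtains z s where "p = [:(cmod z)\<^sup>2, - 2 * Re z, 1:] * s"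
proof -
  have "\<not> constant (poly (map_poly complex_of_real p))"
    using deg by (simp add: constant_degree degree_map_poly)
  then obtain z where z: "poly (map_poly complex_of_real p) z = 0"
    using fundamental_theorem_of_algebra by blast
  show ?thesis
  proof (cases "Im z = 0")
    case True
    define r where "r = Re z"
    have zr: "z = complex_of_real r"
      using True by (simp add: r_def complex_eq_iff)
    have "poly p r = 0"
      using z by (simp add: zr poly_map_poly_of_real)
    then obtain p1 where p1: "p = [:- r, 1:] * p1"
      using poly_eq_0_iff_dvd by (metis dvdE)
    have "poly p1 r \<ge> 0"
    proof (rule poly_nonneg_closure_right)
      fix x assume "x > r"
      then show "poly p1 x \<ge> 0"
        using nonneg[of x] unfolding p1 poly_mult by (auto simp: zero_le_mult_iff)
    qed
    moreover have "poly p1 r \<le> 0"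
    proof (rule poly_nonpos_closure_left)
      fix x assume "x < r"
      then show "poly p1 x \<le> 0"
        using nonneg[of x] unfolding p1 poly_mult by (auto simp: zero_le_mult_iff)
    qed
    ultimately have "poly p1 r = 0" by simp
    then obtain p2 where p2: "p1 = [:- r, 1:] * p2"
      using poly_eq_0_iff_dvd by (metis dvdE)
    have "[:- r, 1:] * [:- r, 1:] = [:(cmod z)\<^sup>2, - 2 * Re z, 1:]"
      by (simp add: zr power2_eq_square)
    then have "p = [:(cmod z)\<^sup>2, - 2 * Re z, 1:] * p2"
      by (metis p1 p2 mult.assoc)
    then show ?thesis using that by blast
  next
    case False
    define D where "D = [:(cmod z)\<^sup>2, - 2 * Re z, 1:]"
    define R where "R = p mod D"
    have D0: "D \<noteq> 0" by (simp add: D_def)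
    have "degree R < 2"
      using degree_mod_less'[of D p] D0 by (cases "R = 0") (auto simp: R_def D_def)
    then have R: "R = [:coeff R 0, coeff R 1:]"
      by (intro poly_eqI) (auto simp: coeff_pCons coeff_eq_0 split: nat.split)
    have eq: "p = p div D * D + R" by (simp add: R_def)
    have "poly (map_poly complex_of_real D) z = 0"
      unfolding D_def
      unfolding cmod_power2
      by (simp add: map_poly_pCons complex_eq_iff power2_eq_square algebra_simps)
    moreover have "map_poly complex_of_real p =
        map_poly complex_of_real (p div D) * map_poly complex_of_real D + map_poly complex_of_real R"
      by (rule poly_eqI_of_real, subst eq)
        (simp only: poly_map_poly_of_real poly_add poly_mult of_real_add of_real_mult)
    ultimately have "poly (map_poly complex_of_real R) z = 0"
      using z by simp
    then have "complex_of_real (coeff R 0) + z * complex_of_real (coeff R 1) = 0"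
      by (subst (asm) R) (simp add: map_poly_pCons)
    then have "coeff R 1 = 0" "coeff R 0 = 0"
      using False by (auto simp: complex_eq_iff)
    then have "R = 0" using R by simp
    then have "p = D * (p div D)" using eq by (simp add: mult.commute)
    then show ?thesis using that unfolding D_def by blast
  qed
qed

text \<open>Each quadratic factor equals |x - z|^2 at real x, so it contributes the linear factor x
  - z to \<open>q\<close>; the quotient stays nonnegative and its degree drops by two.\<close>

lemma nonneg_poly_eq_cmod_power2:
  fixes p :: "real poly"
  assumes "\<And>x. poly p x \<ge> 0"
  shows "\<exists>q. 2 * degree q \<le> degree p \<and> (\<forall>x. (cmod (poly q (complex_of_real x)))\<^sup>2 = poly p x)"
  using assms
proof (induction "degree p" arbitrary: p rule: less_induct)
  case less
  show ?case
  proof (cases "degree p = 0")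
    case True
    then obtain c where c: "p = [:c:]" using degree_eq_zeroE by blast
    then have "c \<ge> 0" using less.prems[of 0] by simp
    then show ?thesis
      by (intro exI[of _ "[:complex_of_real (sqrt c):]"]) (simp add: c)
  next
    case False
    then obtain z s where ps: "p = [:(cmod z)\<^sup>2, - 2 * Re z, 1:] * s"
      using quadratic_factor_of_nonneg_poly[OF less.prems] by blast
    have D: "poly [:(cmod z)\<^sup>2, - 2 * Re z, 1:] x = (cmod (complex_of_real x - z))\<^sup>2" for x
      unfolding cmod_power2 by (simp add: power2_eq_square algebra_simps)
    have s0: "s \<noteq> 0" using False ps by auto
    have dp: "degree p = degree s + 2"
      unfolding ps using s0 by (subst degree_mult_eq) auto
    have pos: "poly s x \<ge> 0" if "x > Re z" for x
    proof -
      have "complex_of_real x - z \<noteq> 0" using that by (auto simp: complex_eq_iff)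
      then have "(cmod (complex_of_real x - z))\<^sup>2 > 0" by simp
      then show ?thesis
        using less.prems[of x] unfolding ps poly_mult D by (simp add: zero_le_mult_iff)
    qed
    \<comment> \<open>Dividing by |x - z|^2 keeps the sign except at x = z, where continuity from
      the right decides.\<close>
    have "poly s x \<ge> 0" for x
    proof (cases "complex_of_real x = z")
      case True
      then have "x = Re z" by auto
      then show ?thesis using poly_nonneg_closure_right pos by blast
    next
      case False
      then have "(cmod (complex_of_real x - z))\<^sup>2 > 0" by simp
      then show ?thesis
        using less.prems[of x] unfolding ps poly_mult D by (simp add: zero_le_mult_iff)
    qed
    then obtain q where q: "2 * degree q \<le> degree s"
        "\<And>x. (cmod (poly q (complex_of_real x)))\<^sup>2 = poly s x"
      using less.hyps[of s] dp by auto
    have "degree ([:- z, 1:] * q) \<le> 1 + degree q"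
      using degree_mult_le[of "[:- z, 1:]" q] by simp
    moreover have "(cmod (poly ([:- z, 1:] * q) (complex_of_real x)))\<^sup>2 = poly p x" for x
      unfolding ps poly_mult D by (simp add: norm_mult power_mult_distrib q(2) del: mult_pCons_left)
    ultimately show ?thesis
      using q(1) dp by (intro exI[of _ "[:- z, 1:] * q"]) auto
  qed
qed

section \<open>Alternating phase rotations in the plane of marked and unmarked amplitudes\<close>

text \<open>Pairs hold the marked amplitude first. Amplitudes are per vertex, relative to the uniform state,
  so \<open>(1, 1)\<close> is the uniform state and the squared norm carries weights \<open>1 - y\<close> and \<open>y\<close>.\<close>

definition diffuse :: "real \<Rightarrow> real \<Rightarrow> complex \<times> complex \<Rightarrow> complex \<times> complex" where
  "diffuse y \<alpha> z = (let m = complex_of_real (1 - y) * fst z + complex_of_real y * snd z;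
     c = 1 - exp (- (\<i> * complex_of_real \<alpha>)) in (fst z - c * m, snd z - c * m))"

definition mark :: "real \<Rightarrow> complex \<times> complex \<Rightarrow> complex \<times> complex" where
  "mark \<beta> z = (exp (\<i> * complex_of_real \<beta>) * fst z, snd z)"

primrec grover :: "real \<Rightarrow> (nat \<Rightarrow> real) \<Rightarrow> (nat \<Rightarrow> real) \<Rightarrow> nat \<Rightarrow> complex \<times> complex" where
  "grover y p q 0 = (1, 1)"
| "grover y p q (Suc n) = diffuse y (p n) (mark (q n) (grover y p q n))"

section \<open>Coefficients of complementary polynomial pairs\<close>

lemma coeff_mult_top:
  fixes p q :: "'a :: comm_semiring_0 poly"
  assumes "degree p \<le> m" "degree q \<le> m"
  shows "coeff (p * q) (2 * m) = coeff p m * coeff q m"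
proof -
  have "coeff (p * q) (2 * m) = (\<Sum>i\<in>{m}. coeff p i * coeff q (2 * m - i))"
    unfolding coeff_mult
  proof (rule sum.mono_neutral_right)
    show "\<forall>i\<in>{..2 * m} - {m}. coeff p i * coeff q (2 * m - i) = 0"
    proof
      fix i assume "i \<in> {..2 * m} - {m}"
      then have "i > m \<or> 2 * m - i > m" by auto
      then show "coeff p i * coeff q (2 * m - i) = 0"
        using assms by (auto simp: coeff_eq_0)
    qed
  qed auto
  then show ?thesis by (simp add: mult_2)
qed

lemma coeff_mult_second:
  fixes p q :: "'a :: comm_semiring_0 poly"
  assumes "degree p \<le> Suc m" "degree q \<le> Suc m"
  shows "coeff (p * q) (2 * m + 1) = coeff p (Suc m) * coeff q m + coeff p m * coeff q (Suc m)"
proof -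
  have "coeff (p * q) (2 * m + 1) = (\<Sum>i\<in>{m, Suc m}. coeff p i * coeff q (2 * m + 1 - i))"
    unfolding coeff_mult
  proof (rule sum.mono_neutral_right)
    show "\<forall>i\<in>{..2 * m + 1} - {m, Suc m}. coeff p i * coeff q (2 * m + 1 - i) = 0"
    proof
      fix i assume "i \<in> {..2 * m + 1} - {m, Suc m}"
      then have "i > Suc m \<or> 2 * m + 1 - i > Suc m" by auto
      then show "coeff p i * coeff q (2 * m + 1 - i) = 0"
        using assms by (auto simp: coeff_eq_0)
    qed
  qed auto
  then show ?thesis by (simp add: mult_2 Suc_diff_le add.commute)
qed

text \<open>This is norm preservation with \<open>y\<close> as the unmarked fraction, asked of all
  real \<open>y\<close> so that \<open>poly_eqI_of_real\<close> turns it into an identity of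
  polynomials.\<close>

definition complementary :: "complex poly \<Rightarrow> complex poly \<Rightarrow> bool" where
  "complementary P Q \<longleftrightarrow> (\<forall>y. y * (cmod (poly P (complex_of_real y)))\<^sup>2 +
     (1 - y) * (cmod (poly Q (complex_of_real y)))\<^sup>2 = 1)"

lemma degree_map_poly_cnj [simp]: "degree (map_poly cnj p) = degree p"
  by (rule degree_map_poly) simp

text \<open>At real points |P|^2 is the value of \<open>P * map_poly cnj P\<close>, and likewise for
  \<open>Q\<close>; the claim compares the coefficients at \<open>Suc k\<close>, where the constant
  1 has none.\<close>

lemma coeff_complementary:
  assumes "complementary P Q"
  shows "coeff (P * map_poly cnj P) k + coeff (Q * map_poly cnj Q) (Suc k) =
    coeff (Q * map_poly cnj Q) k"
proof -
  let ?P = "P * map_poly cnj P" and ?Q = "Q * map_poly cnj Q"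
  have ev: "poly (R * map_poly cnj R) (complex_of_real y) =
      complex_of_real ((cmod (poly R (complex_of_real y)))\<^sup>2)" for R y
    by (metis poly_mult poly_cnj complex_cnj_complex_of_real complex_norm_square of_real_power)
  have "pCons 0 ?P + (?Q - pCons 0 ?Q) = 1"
  proof (rule poly_eqI_of_real)
    fix y
    have "poly (pCons 0 ?P + (?Q - pCons 0 ?Q)) (complex_of_real y) =
       complex_of_real (y * (cmod (poly P (complex_of_real y)))\<^sup>2 +
         (1 - y) * (cmod (poly Q (complex_of_real y)))\<^sup>2)"
      unfolding poly_add poly_diff poly_pCons ev by (simp add: algebra_simps)
    also have "\<dots> = 1"
      using assms unfolding complementary_def by (simp only: of_real_1)
    finally show "poly (pCons 0 ?P + (?Q - pCons 0 ?Q)) (complex_of_real y) =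
        poly 1 (complex_of_real y)" by simp
  qed
  then have "coeff (pCons 0 ?P + (?Q - pCons 0 ?Q)) (Suc k) = 0"
    by simp
  then show ?thesis by (simp add: algebra_simps)
qed

text \<open>The two lemmas below read off the coefficients at \<open>y ^ (2 m + 1)\<close> and \<open>y ^ (2 m + 2)\<close> of
  \<open>y |P|\<^sup>2 + (1 - y) |Q|\<^sup>2 = 1\<close>.\<close>

lemma complementary_lead:
  assumes "complementary P Q" "degree P \<le> m" "degree Q \<le> m"
  shows "cmod (coeff P m) = cmod (coeff Q m)"
proof -
  have "degree (Q * map_poly cnj Q) \<le> 2 * m"
    using degree_mult_le[of Q "map_poly cnj Q"] assms(3) by simp
  then have "coeff (Q * map_poly cnj Q) (Suc (2 * m)) = 0"
    by (simp add: coeff_eq_0)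
  then have "coeff P m * cnj (coeff P m) = coeff Q m * cnj (coeff Q m)"
    using coeff_complementary[OF assms(1), of "2 * m"] assms(2,3)
    by (simp add: coeff_mult_top coeff_map_poly)
  then have "complex_of_real ((cmod (coeff P m))\<^sup>2) = complex_of_real ((cmod (coeff Q m))\<^sup>2)"
    by (metis complex_norm_square of_real_power)
  then have "(cmod (coeff P m))\<^sup>2 = (cmod (coeff Q m))\<^sup>2"
    using of_real_eq_iff by blast
  then show ?thesis by (simp add: power2_eq_iff_nonneg)
qed

lemma complementary_second:
  assumes "complementary P Q" "degree P \<le> Suc m" "degree Q \<le> Suc m"
    and "coeff P (Suc m) = l" "coeff Q (Suc m) = l"
  shows "cmod (l + (coeff P m - coeff Q m)) = cmod (coeff P m - coeff Q m)"
proof -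
  define w where "w = coeff P m - coeff Q m"
  have "coeff (Q * map_poly cnj Q) (Suc (2 * m + 1)) = l * cnj l"
    using coeff_mult_top[of Q "Suc m" "map_poly cnj Q"] assms(3,5) by (simp add: coeff_map_poly)
  then have "l * cnj w + w * cnj l + l * cnj l = 0"
    using coeff_complementary[OF assms(1), of "2 * m + 1"]
      coeff_mult_second[of P m "map_poly cnj P"] coeff_mult_second[of Q m "map_poly cnj Q"] assms(2-)
    by (simp add: coeff_map_poly w_def algebra_simps)
  then have "(l + w) * cnj (l + w) = w * cnj w"
    by (simp add: algebra_simps)
  then have "complex_of_real ((cmod (l + w))\<^sup>2) = complex_of_real ((cmod w)\<^sup>2)"
    by (metis complex_norm_square of_real_power)
  then have "(cmod (l + w))\<^sup>2 = (cmod w)\<^sup>2"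
    using of_real_eq_iff by blast
  then show ?thesis by (simp add: power2_eq_iff_nonneg w_def)
qed

section \<open>Synthesis of complementary pairs by rotations\<close>

lemma unit_eq_exp:
  assumes "cmod z = 1"
  obtains t where "z = exp (\<i> * complex_of_real t)"
  using assms by (metis cis_Arg cis_conv_exp norm_zero sgn_eq div_by_1 of_real_1 zero_neq_one)

lemma grover_cong:
  assumes "\<And>k. k < n \<Longrightarrow> p k = p' k" "\<And>k. k < n \<Longrightarrow> q k = q' k"
  shows "grover y p q n = grover y p' q' n"
  using assms by (induction n) auto

text \<open>The inner diffusion multiplies the weighted mean \<open>m\<close> by \<open>u\<close>,
  so the outer one subtracts \<open>(1 - v) * (u * m)\<close>, which is \<open>u * m - m\<close> and
  undoes the first subtraction.\<close>

lemma diffuse_minus: "diffuse y \<alpha> (diffuse y (- \<alpha>) z) = z"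
proof -
  define u where "u = exp (\<i> * complex_of_real \<alpha>)"
  define v where "v = exp (- (\<i> * complex_of_real \<alpha>))"
  have "v * u = 1" by (simp add: u_def v_def mult_exp_exp)
  moreover have "exp (- (\<i> * complex_of_real (- \<alpha>))) = u" by (simp add: u_def)
  moreover define m where "m = complex_of_real (1 - y) * fst z + complex_of_real y * snd z"
  moreover have "complex_of_real (1 - y) * (fst z - (1 - u) * m) +
      complex_of_real y * (snd z - (1 - u) * m) = u * m"
    by (simp add: m_def algebra_simps)
  ultimately have "diffuse y \<alpha> (diffuse y (- \<alpha>) z) =
      (fst z - (1 - u) * m - (1 - v) * (u * m), snd z - (1 - u) * m - (1 - v) * (u * m))"
    unfolding diffuse_def Let_def fst_conv snd_conv by (simp only: v_def)
  moreover have "(1 - v) * (u * m) = u * m - m"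
    using \<open>v * u = 1\<close> by (simp add: left_diff_distrib mult.assoc[symmetric])
  ultimately show ?thesis by (simp only:) (simp add: algebra_simps)
qed

text \<open>The cross terms add up to minus (c + cnj c) |m|^2 and cancel against c cnj c |m|^2. The
  computation is purely algebraic, so it covers real \<open>y\<close> outside [0, 1], where one
  weight is negative.\<close>

lemma diffuse_norm:
  "y * (cmod (snd (diffuse y \<alpha> z)))\<^sup>2 + (1 - y) * (cmod (fst (diffuse y \<alpha> z)))\<^sup>2 =
    y * (cmod (snd z))\<^sup>2 + (1 - y) * (cmod (fst z))\<^sup>2"
proof -
  define c where "c = 1 - exp (- (\<i> * complex_of_real \<alpha>))"
  define Y where "Y = complex_of_real y"
  define m where "m = (1 - Y) * fst z + Y * snd z"
  have "exp (- (\<i> * complex_of_real \<alpha>)) * cnj (exp (- (\<i> * complex_of_real \<alpha>))) = 1"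
    by (simp add: exp_cnj mult_exp_exp)
  then have "(1 - c) * (1 - cnj c) = 1" by (simp add: c_def)
  then have c: "c * cnj c = c + cnj c" by (simp add: algebra_simps)
  have m: "cnj m = (1 - Y) * cnj (fst z) + Y * cnj (snd z)" by (simp add: m_def Y_def)
  have d: "diffuse y \<alpha> z = (fst z - c * m, snd z - c * m)"
    by (simp add: diffuse_def c_def m_def Y_def Let_def)
  have "Y * ((snd z - c * m) * cnj (snd z - c * m)) + (1 - Y) * ((fst z - c * m) * cnj (fst z - c * m)) =
      Y * (snd z * cnj (snd z)) + (1 - Y) * (fst z * cnj (fst z)) - c * m * cnj m - cnj c * cnj m * m
        + c * cnj c * (m * cnj m)"
  proof -
    have "Y * ((snd z - c * m) * cnj (snd z - c * m)) + (1 - Y) * ((fst z - c * m) * cnj (fst z - c * m)) =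
      Y * (snd z * cnj (snd z)) + (1 - Y) * (fst z * cnj (fst z))
        - c * m * ((1 - Y) * cnj (fst z) + Y * cnj (snd z))
        - cnj c * cnj m * ((1 - Y) * fst z + Y * snd z) + c * cnj c * (m * cnj m)"
      by (simp add: algebra_simps)
    then show ?thesis by (simp only: m[symmetric] m_def[symmetric])
  qed
  also have "\<dots> = Y * (snd z * cnj (snd z)) + (1 - Y) * (fst z * cnj (fst z))"
    unfolding c by (simp add: algebra_simps)
  finally have "complex_of_real (y * (cmod (snd z - c * m))\<^sup>2 + (1 - y) * (cmod (fst z - c * m))\<^sup>2) =
      complex_of_real (y * (cmod (snd z))\<^sup>2 + (1 - y) * (cmod (fst z))\<^sup>2)"
    unfolding of_real_add of_real_mult of_real_diff of_real_1 Y_def complex_norm_square .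
  then show ?thesis unfolding d fst_conv snd_conv of_real_eq_iff .
qed

text \<open>An inverse diffusion subtracts from both polynomials the same multiple of their mean
  polynomial. With equal leading coefficients a single multiplier cancels both, and
  \<open>complementary_second\<close> ensures that this multiplier comes from a phase.\<close>

lemma complementary_reduce:
  assumes comp: "complementary P Q" and deg: "degree P \<le> Suc m" "degree Q \<le> Suc m"
    and lead: "coeff P (Suc m) = coeff Q (Suc m)"
  obtains P' Q' \<alpha> where "complementary P' Q'" "degree P' \<le> m" "degree Q' \<le> m"
    "\<And>y. diffuse y \<alpha> (poly Q' (complex_of_real y), poly P' (complex_of_real y)) =
       (poly Q (complex_of_real y), poly P (complex_of_real y))"
proof -
  define l where "l = coeff Q (Suc m)"
  define w where "w = coeff P m - coeff Q m"
  have lw: "cmod (l + w) = cmod w"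
    unfolding l_def w_def by (rule complementary_second[OF comp deg lead refl])
  \<comment> \<open>Solves \<open>(1 - u) * (l + w) = l\<close>, because the mean \<open>M\<close>
    below has coefficient \<open>l + w\<close> at \<open>Suc m\<close>. If \<open>l + w = 0\<close>,
    then \<open>w\<close> and \<open>l\<close> vanish too and 1 will do.\<close>
  define u where "u = (if l + w = 0 then 1 else w / (l + w))"
  have "cmod u = 1" using lw by (auto simp: u_def norm_divide)
  then obtain \<alpha> where u: "u = exp (\<i> * complex_of_real \<alpha>)" by (rule unit_eq_exp)
  have cl: "(1 - u) * (l + w) = l"
  proof (cases "l + w = 0")
    case True
    then have "l = 0" using lw by auto
    then show ?thesis using True by simp
  next
    case False
    then show ?thesis by (simp add: u_def field_simps)
  qed
  define M where "M = Q + pCons 0 (P - Q)"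
  define P' where "P' = P - smult (1 - u) M"
  define Q' where "Q' = Q - smult (1 - u) M"
  \<comment> \<open>The shift by \<open>pCons\<close> could raise the degree of \<open>M\<close> to
    m + 2; equality of the leading coefficients prevents this.\<close>
  have top: "coeff P k = (1 - u) * coeff M k \<and> coeff Q k = (1 - u) * coeff M k" if "k > m" for k
  proof -
    obtain j where k: "k = Suc j" using \<open>k > m\<close> by (cases k) auto
    show ?thesis
    proof (cases "j = m")
      case True
      then show ?thesis using cl lead by (simp add: k M_def l_def w_def)
    next
      case False
      then have j: "j > m" using that k by simp
      then have "coeff P j = coeff Q j"
        using lead deg by (cases "j = Suc m") (auto simp: coeff_eq_0)
      then show ?thesis using j deg by (simp add: k M_def coeff_eq_0)
    qed
  qed
  have step: "(poly Q' (complex_of_real y), poly P' (complex_of_real y)) =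
      diffuse y (- \<alpha>) (poly Q (complex_of_real y), poly P (complex_of_real y))" for y
    by (simp add: Q'_def P'_def M_def diffuse_def u algebra_simps)
  show ?thesis
  proof (rule that)
    show "complementary P' Q'"
      unfolding complementary_def
    proof
      fix y
      have "y * (cmod (poly P' (complex_of_real y)))\<^sup>2 + (1 - y) * (cmod (poly Q' (complex_of_real y)))\<^sup>2
        = y * (cmod (poly P (complex_of_real y)))\<^sup>2 + (1 - y) * (cmod (poly Q (complex_of_real y)))\<^sup>2"
        using diffuse_norm[of y "- \<alpha>" "(poly Q (complex_of_real y), poly P (complex_of_real y))"]
        unfolding step[symmetric] fst_conv snd_conv .
      then show "y * (cmod (poly P' (complex_of_real y)))\<^sup>2 +
          (1 - y) * (cmod (poly Q' (complex_of_real y)))\<^sup>2 = 1"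
        using comp by (simp add: complementary_def)
    qed
    show "degree P' \<le> m" "degree Q' \<le> m"
      using top by (auto intro!: degree_le simp: P'_def Q'_def)
    show "diffuse y \<alpha> (poly Q' (complex_of_real y), poly P' (complex_of_real y)) =
       (poly Q (complex_of_real y), poly P (complex_of_real y))" for y
      unfolding step by (rule diffuse_minus)
  qed
qed

text \<open>Rotations are peeled off starting with the last one. The unit factors \<open>c\<close>
  and \<open>g\<close> leave the phases of both amplitudes free, since only their moduli enter the
  measurement.\<close>

lemma grover_synthesis:
  assumes "complementary P Q" "degree P \<le> n" "degree Q \<le> n"
  shows "\<exists>p q g c. cmod g = 1 \<and> cmod c = 1 \<and>
    (\<forall>y. grover y p q n = (c * poly Q (complex_of_real y), g * poly P (complex_of_real y)))"
  using assms
proof (induction n arbitrary: P Q)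
  case 0
  then obtain a b where ab: "P = [:a:]" "Q = [:b:]" by (metis degree_eq_zeroE le_zero_eq)
  have "cmod a = 1"
    by (rule power2_eq_imp_eq) (use 0(1)[unfolded complementary_def, rule_format, of 1] in \<open>simp_all add: ab\<close>)
  moreover have "cmod b = 1"
    by (rule power2_eq_imp_eq) (use 0(1)[unfolded complementary_def, rule_format, of 0] in \<open>simp_all add: ab\<close>)
  ultimately show ?case
    by (intro exI[of _ "\<lambda>_. 0"] exI[of _ "1 / a"] exI[of _ "1 / b"]) (auto simp: ab norm_divide)
next
  case (Suc n)
  \<comment> \<open>A unit number by \<open>complementary_lead\<close>; it aligns the leading
    coefficient of \<open>Q\<close> with that of \<open>P\<close>.\<close>
  define d where "d = (if coeff Q (Suc n) = 0 then 1 else coeff P (Suc n) / coeff Q (Suc n))"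
  have lead: "cmod (coeff P (Suc n)) = cmod (coeff Q (Suc n))"
    using complementary_lead Suc.prems by blast
  then have d: "cmod d = 1" by (auto simp: d_def norm_divide)
  have "complementary P (smult d Q)"
    using Suc.prems(1) d by (simp add: complementary_def norm_mult)
  moreover have "degree (smult d Q) \<le> Suc n" using Suc.prems(3) d by auto
  moreover have "coeff P (Suc n) = coeff (smult d Q) (Suc n)" using lead by (auto simp: d_def)
  ultimately obtain P' Q' \<alpha> where red: "complementary P' Q'" "degree P' \<le> n" "degree Q' \<le> n"
    "\<And>y. diffuse y \<alpha> (poly Q' (complex_of_real y), poly P' (complex_of_real y)) =
       (poly (smult d Q) (complex_of_real y), poly P (complex_of_real y))"
    using complementary_reduce[of P "smult d Q" n] Suc.prems(2) by blast
  obtain p q g c where IH: "cmod g = 1" "cmod c = 1"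
    "\<And>y. grover y p q n = (c * poly Q' (complex_of_real y), g * poly P' (complex_of_real y))"
    using Suc.IH[OF red(1-3)] by blast
  \<comment> \<open>The marking phase turns the factor \<open>c\<close> of the marked amplitude into
    \<open>g\<close>, so that the last diffusion acts on a common multiple of the reduced
    pair.\<close>
  have "cmod (g / c) = 1" using IH by (simp add: norm_divide)
  then obtain \<beta> where \<beta>: "g / c = exp (\<i> * complex_of_real \<beta>)" by (rule unit_eq_exp)
  have c0: "c \<noteq> 0" using IH by auto
  have lin: "diffuse y \<alpha> (g * a, g * b) = (g * fst (diffuse y \<alpha> (a, b)), g * snd (diffuse y \<alpha> (a, b)))"
    for y a b by (simp add: diffuse_def Let_def algebra_simps)
  have "grover y (p(n := \<alpha>)) (q(n := \<beta>)) (Suc n) =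
     (g * d * poly Q (complex_of_real y), g * poly P (complex_of_real y))" for y
  proof -
    have "grover y (p(n := \<alpha>)) (q(n := \<beta>)) n = grover y p q n"
      by (rule grover_cong) auto
    then have "grover y (p(n := \<alpha>)) (q(n := \<beta>)) (Suc n) =
        diffuse y \<alpha> (g * poly Q' (complex_of_real y), g * poly P' (complex_of_real y))"
      using c0 by (simp add: IH(3) mark_def \<beta>[symmetric])
    also have "\<dots> = (g * d * poly Q (complex_of_real y), g * poly P (complex_of_real y))"
      unfolding lin red(4) by simp
    finally show ?thesis .
  qed
  moreover have "cmod (g * d) = 1" using IH d by (simp add: norm_mult)
  ultimately show ?case using IH(1) by blast
qed

section \<open>The Chebyshev target\<close>

text \<open>The Chebyshev polynomial of degree \<open>2 n + 1\<close> is \<open>z * cheb_odd n (z\<^sup>2)\<close>.\<close>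

fun cheb_odd :: "nat \<Rightarrow> real poly" where
  "cheb_odd 0 = 1"
| "cheb_odd (Suc 0) = [:-3, 4:]"
| "cheb_odd (Suc (Suc n)) = [:-2, 4:] * cheb_odd (Suc n) - cheb_odd n"

lemma degree_cheb_odd: "degree (cheb_odd n) \<le> n"
proof (induction n rule: cheb_odd.induct)
  case (3 n)
  have "degree ([:-2, 4:] * cheb_odd (Suc n)) \<le> Suc (Suc n)"
    using degree_mult_le[of "[:-2, 4:]" "cheb_odd (Suc n)"] 3 by simp
  then show ?case using 3 by (simp add: degree_diff_le)
qed auto

text \<open>Both sides obey the recurrence cos (a + 2x) = 2 cos 2x cos a - cos (a - 2x), where 2 cos
  2x = 4 cos^2 x - 2 is the value of \<open>[:-2, 4:]\<close>.\<close>

lemma cos_cheb_odd: "cos (real (2 * n + 1) * x) = cos x * poly (cheb_odd n) ((cos x)\<^sup>2)"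
proof (induction n rule: cheb_odd.induct)
  case 2
  have "cos (3 * x) = 4 * cos x ^ 3 - 3 * cos x" by (rule cos_treble_cos)
  then show ?case by (simp add: power2_eq_square power3_eq_cube algebra_simps)
next
  case (3 n)
  define a where "a = real (2 * n + 3) * x"
  have "cos (a + 2 * x) + cos (a - 2 * x) = 2 * cos (2 * x) * cos a"
    by (simp add: cos_add cos_diff)
  moreover have "a + 2 * x = real (2 * Suc (Suc n) + 1) * x" "a - 2 * x = real (2 * n + 1) * x"
    "a = real (2 * Suc n + 1) * x" by (simp_all add: a_def algebra_simps)
  ultimately have "cos (real (2 * Suc (Suc n) + 1) * x) =
    2 * cos (2 * x) * cos (real (2 * Suc n + 1) * x) - cos (real (2 * n + 1) * x)"
    by (metis add_diff_cancel_right')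
  then show ?case
    unfolding 3 cos_double_cos by (simp add: algebra_simps del: of_nat_Suc)
qed auto

text \<open>The same recurrence holds for cosh and describes the Chebyshev polynomial at arguments
  from 1 on.\<close>

lemma cosh_cheb_odd:
  fixes x :: real
  shows "cosh (real (2 * n + 1) * x) = cosh x * poly (cheb_odd n) ((cosh x)\<^sup>2)"
proof -
  have sum: "cosh (a + 2 * x) = (4 * (cosh x)\<^sup>2 - 2) * cosh a - cosh (a - 2 * x)" for a :: real
  proof -
    have "cosh (a + 2 * x) + cosh (a - 2 * x) = 2 * cosh (2 * x) * cosh a"
      by (simp add: cosh_add cosh_diff)
    then show ?thesis unfolding cosh_double_cosh by (simp add: algebra_simps)
  qed
  show ?thesis
  proof (induction n rule: cheb_odd.induct)
    case 2
    have "x + 2 * x = real (2 * Suc 0 + 1) * x" "x - 2 * x = - x" by simp_all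
    then show ?case using sum[of x] by (simp add: algebra_simps)
  next
    case (3 n)
    have "cosh (real (2 * Suc (Suc n) + 1) * x) = (4 * (cosh x)\<^sup>2 - 2) * cosh (real (2 * Suc n + 1) * x)
      - cosh (real (2 * n + 1) * x)"
      using sum[of "real (2 * Suc n + 1) * x"] by (simp add: algebra_simps)
    then show ?case unfolding 3 by (simp add: algebra_simps del: of_nat_Suc)
  qed auto
qed

lemma cheb_odd_bounded:
  assumes "0 \<le> z" "z \<le> 1"
  shows "(z * poly (cheb_odd n) (z\<^sup>2))\<^sup>2 \<le> 1"
proof -
  have "cos (arccos z) = z" using assms by simp
  then have "z * poly (cheb_odd n) (z\<^sup>2) = cos (real (2 * n + 1) * arccos z)"
    using cos_cheb_odd[of n "arccos z"] by simp
  then show ?thesis by (simp only: abs_square_le_1 abs_cos_le_one)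
qed

lemma cheb_odd_mono:
  assumes "1 \<le> x" "x \<le> y"
  shows "1 \<le> x * poly (cheb_odd n) (x\<^sup>2)"
    and "x * poly (cheb_odd n) (x\<^sup>2) \<le> y * poly (cheb_odd n) (y\<^sup>2)"
proof -
  have eq: "z * poly (cheb_odd n) (z\<^sup>2) = cosh (real (2 * n + 1) * arcosh z)" if "z \<ge> 1" for z
    using cosh_cheb_odd[of n "arcosh z"] that by simp
  have "arcosh x \<le> arcosh y"
    using assms arcosh_less_iff_real[of y x] by (simp add: not_less[symmetric] del: arcosh_less_iff_real)
  then have "real (2 * n + 1) * arcosh x \<le> real (2 * n + 1) * arcosh y"
    by (intro mult_left_mono) auto
  then show "1 \<le> x * poly (cheb_odd n) (x\<^sup>2)"
    and "x * poly (cheb_odd n) (x\<^sup>2) \<le> y * poly (cheb_odd n) (y\<^sup>2)"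
    using assms by (simp_all only: eq cosh_real_ge_1 cosh_real_nonneg_le_iff mult_nonneg_nonneg
        of_nat_0_le_iff arcosh_nonneg_real)
qed

text \<open>At y = 1 the function 1 - y |P|^2 vanishes by the choice of \<open>\<kappa>\<close>. It
  is nonnegative below 1 and nonpositive above, because the Chebyshev polynomial is bounded by 1 on
  [0, 1] and nondecreasing afterwards. This makes the quotient by 1 - y nonnegative.\<close>

lemma fixed_point_polynomial:
  fixes \<delta> :: real and n :: nat
  assumes \<delta>: "0 < \<delta>" "\<delta> \<le> 1"
  defines "\<kappa> \<equiv> cosh (arcosh (1 / \<delta>) / real (2 * n + 1))"
  obtains P Q where "complementary P Q" "degree P \<le> n" "degree Q \<le> n"
    "\<And>y. 0 \<le> y \<Longrightarrow> \<kappa>\<^sup>2 * y \<le> 1 \<Longrightarrow> y * (cmod (poly P (complex_of_real y)))\<^sup>2 \<le> \<delta>\<^sup>2"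
proof -
  define T where "T z = z * poly (cheb_odd n) (z\<^sup>2)" for z
  \<comment> \<open>As \<open>T\<close> is odd, \<delta> T(\<kappa> sqrt y) is sqrt y times a
    polynomial in y. That polynomial is \<open>a\<close>, and it becomes \<open>P\<close>.\<close>
  define a where "a = smult (\<delta> * \<kappa>) (pcompose (cheb_odd n) [:0, \<kappa>\<^sup>2:])"
  have \<kappa>: "\<kappa> \<ge> 1" unfolding \<kappa>_def by (rule cosh_real_ge_1)
  have T\<kappa>: "T \<kappa> = 1 / \<delta>"
  proof -
    have "T \<kappa> = cosh (real (2 * n + 1) * (arcosh (1 / \<delta>) / real (2 * n + 1)))"
      unfolding T_def \<kappa>_def by (rule cosh_cheb_odd[symmetric])
    also have "real (2 * n + 1) * (arcosh (1 / \<delta>) / real (2 * n + 1)) = arcosh (1 / \<delta>)"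
      by simp
    finally show ?thesis using \<delta> by simp
  qed
  have aT: "y * (poly a y)\<^sup>2 = \<delta>\<^sup>2 * (T (\<kappa> * sqrt y))\<^sup>2" if "y \<ge> 0" for y
    using that by (simp add: a_def T_def poly_pcompose power_mult_distrib mult_ac)
  have dega: "degree a \<le> n"
    using degree_cheb_odd[of n] \<kappa> by (auto simp: a_def degree_pcompose)
  define r where "r = 1 - pCons 0 (a * a)"
  have r: "poly r y = 1 - y * (poly a y)\<^sup>2" for y by (simp add: r_def power2_eq_square)
  have "poly r 1 = 0" using aT[of 1] T\<kappa> \<delta> by (simp add: r power_one_over)
  then obtain s where s: "r = [:-1, 1:] * s" using poly_eq_0_iff_dvd by (metis dvdE)
  define g where "g = - s"
  have g: "(1 - y) * poly g y = 1 - y * (poly a y)\<^sup>2" for y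
    unfolding r[symmetric] s g_def by (simp add: algebra_simps)
  have "degree g \<le> 2 * n"
  proof (cases "s = 0")
    case False
    have "degree r \<le> Suc (2 * n)"
      unfolding r_def using degree_mult_le[of a a] dega
      by (intro degree_diff_le degree_pCons_le[THEN order_trans]) auto
    moreover have "degree r = 1 + degree s" unfolding s using False by (subst degree_mult_eq) auto
    ultimately show ?thesis by (simp add: g_def)
  qed (simp add: g_def)
  have gt: "poly g y \<ge> 0" if "y > 1" for y
  proof -
    have "\<kappa> * 1 \<le> \<kappa> * sqrt y" using that \<kappa> by (intro mult_left_mono) auto
    then have "1 / \<delta> \<le> T (\<kappa> * sqrt y)"
      unfolding T\<kappa>[symmetric] T_def using \<kappa> by (intro cheb_odd_mono(2)) simp_all
    then have "1 \<le> \<delta> * T (\<kappa> * sqrt y)" using \<delta> by (simp add: field_simps)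
    then have "1\<^sup>2 \<le> (\<delta> * T (\<kappa> * sqrt y))\<^sup>2" by (intro power_mono) auto
    then have "(1 - y) * poly g y \<le> 0" using that by (simp add: g aT power_mult_distrib)
    then show ?thesis using that by (simp add: mult_le_0_iff)
  qed
  have small: "y * (poly a y)\<^sup>2 \<le> \<delta>\<^sup>2" if "0 \<le> y" "\<kappa>\<^sup>2 * y \<le> 1" for y
  proof -
    have "(\<kappa> * sqrt y)\<^sup>2 \<le> 1" using that by (simp add: power_mult_distrib)
    then have "\<kappa> * sqrt y \<le> 1" by (simp add: abs_square_le_1)
    then have "(T (\<kappa> * sqrt y))\<^sup>2 \<le> 1"
      unfolding T_def using \<kappa> that by (intro cheb_odd_bounded) auto
    then show ?thesis unfolding aT[OF that(1)] by (intro mult_left_le) auto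
  qed
  \<comment> \<open>Three ranges: for negative \<open>y\<close> the product is at most 0; up to 1 /
    \<kappa>^2 the oscillation bound applies; from there to 1 the value of \<open>T\<close> climbs
    at most to \<open>1 / \<delta>\<close>.\<close>
  have lt: "poly g y \<ge> 0" if "y < 1" for y
  proof -
    have "y * (poly a y)\<^sup>2 \<le> 1"
    proof (cases "0 \<le> y \<and> \<kappa>\<^sup>2 * y > 1")
      case True
      have "1\<^sup>2 < (\<kappa> * sqrt y)\<^sup>2" using True by (simp add: power_mult_distrib)
      then have "1 \<le> \<kappa> * sqrt y" using \<kappa> True by (smt (verit) power_less_imp_less_base mult_nonneg_nonneg real_sqrt_ge_zero)
      moreover have "\<kappa> * sqrt y \<le> \<kappa> * 1" using that \<kappa> by (intro mult_left_mono) auto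
      ultimately have "1 \<le> T (\<kappa> * sqrt y)" "T (\<kappa> * sqrt y) \<le> 1 / \<delta>"
        using cheb_odd_mono[of "\<kappa> * sqrt y" \<kappa> n] unfolding T\<kappa>[symmetric] T_def
        by (simp_all only: mult_1_right)
      then have "\<delta> * T (\<kappa> * sqrt y) \<le> 1" "0 \<le> \<delta> * T (\<kappa> * sqrt y)"
        using \<delta> by (simp_all add: field_simps)
      then have "(\<delta> * T (\<kappa> * sqrt y))\<^sup>2 \<le> 1" by (simp add: abs_square_le_1)
      then show ?thesis using True by (simp add: aT power_mult_distrib)
    next
      case False
      then consider "y < 0" | "0 \<le> y" "\<kappa>\<^sup>2 * y \<le> 1" by linarith
      then show ?thesis
      proof cases
        case 1
        then have "y * (poly a y)\<^sup>2 \<le> 0" by (simp add: mult_le_0_iff)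
        then show ?thesis by simp
      next
        case 2
        have "\<delta>\<^sup>2 \<le> 1" using \<delta> by (simp add: abs_square_le_1)
        then show ?thesis using small[OF 2] by simp
      qed
    qed
    then have "(1 - y) * poly g y \<ge> 0" by (simp add: g)
    then show ?thesis using that by (simp add: zero_le_mult_iff)
  qed
  have "poly g y \<ge> 0" for y
    using gt lt poly_nonneg_closure_right[of 1 g] by (cases y "1::real" rule: linorder_cases) auto
  then obtain Q where Q: "2 * degree Q \<le> degree g"
      "\<And>x. (cmod (poly Q (complex_of_real x)))\<^sup>2 = poly g x"
    using nonneg_poly_eq_cmod_power2 by blast
  show ?thesis
  proof (rule that)
    show "complementary (map_poly complex_of_real a) Q"
      by (simp add: complementary_def poly_map_poly_of_real Q(2) g)
    show "degree (map_poly complex_of_real a) \<le> n" using dega by (simp add: degree_map_poly)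
    show "degree Q \<le> n" using Q(1) \<open>degree g \<le> 2 * n\<close> by simp
    show "y * (cmod (poly (map_poly complex_of_real a) (complex_of_real y)))\<^sup>2 \<le> \<delta>\<^sup>2"
      if "0 \<le> y" "\<kappa>\<^sup>2 * y \<le> 1" for y
      using small[OF that] by (simp add: poly_map_poly_of_real)
  qed
qed

section \<open>The fixed-point bound in terms of the number of vertices\<close>

lemma tanh_le_self:
  assumes "(x :: real) \<ge> 0"
  shows "tanh x \<le> x"
proof -
  have "0 - tanh 0 \<le> x - tanh x"
  proof (rule DERIV_nonneg_imp_nondecreasing[OF assms, of "\<lambda>x. x - tanh x"])
    fix t :: real
    have "((\<lambda>x. x - tanh x) has_real_derivative (tanh t)\<^sup>2) (at t)"
      by (auto intro!: derivative_eq_intros)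
    then show "\<exists>y. ((\<lambda>x. x - tanh x) has_real_derivative y) (at t) \<and> 0 \<le> y"
      by (meson zero_le_power2)
  qed
  then show ?thesis by simp
qed

text \<open>Bounding the square root in the formula for arcosh by \<open>x\<close> is the source of
  the 2 inside the logarithm of the step bound.\<close>

lemma arcosh_le_ln:
  assumes "(x :: real) \<ge> 1"
  shows "arcosh x \<le> ln (2 * x)"
proof -
  have "sqrt (x\<^sup>2 - 1) \<le> x" using assms by (intro real_le_lsqrt) auto
  then have "ln (x + sqrt (x\<^sup>2 - 1)) \<le> ln (2 * x)"
    using assms by (intro ln_mono) (auto intro: add_pos_nonneg)
  then show ?thesis using assms by (simp add: arcosh_real_def)
qed

text \<open>With \<kappa> = cosh t, the good range of \<open>fixed_point_polynomial\<close> ends at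
  1 / cosh^2 t = 1 - tanh^2 t. The assumption on \<open>n\<close> gives tanh^2 t \<le> t^2 \<le> 1 /
  N. One marked vertex among at most \<open>N\<close> already puts the unmarked fraction into this
  range.\<close>

lemma fixed_point_phases:
  fixes \<delta> :: real and N n :: nat
  assumes \<delta>: "0 < \<delta>" "\<delta> \<le> 1" and N: "N \<ge> 1"
    and n: "ln (2 / \<delta>) * sqrt (real N) \<le> real (2 * n + 1)"
  shows "\<exists>p q. \<forall>y. 0 \<le> y \<and> y \<le> 1 - 1 / real N \<longrightarrow> y * (cmod (snd (grover y p q n)))\<^sup>2 \<le> \<delta>\<^sup>2"
proof -
  define t where "t = arcosh (1 / \<delta>) / real (2 * n + 1)"
  have "t \<ge> 0" using \<delta> by (simp add: t_def)
  have "arcosh (1 / \<delta>) \<le> ln (2 / \<delta>)" using arcosh_le_ln[of "1 / \<delta>"] \<delta> by simp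
  then have "arcosh (1 / \<delta>) * sqrt (real N) \<le> real (2 * n + 1)"
    using n mult_right_mono[of "arcosh (1 / \<delta>)" "ln (2 / \<delta>)" "sqrt (real N)"] by simp
  then have "t * sqrt (real N) \<le> 1" by (simp add: t_def field_simps)
  then have "(t * sqrt (real N))\<^sup>2 \<le> 1" using \<open>t \<ge> 0\<close> by (simp add: abs_square_le_1)
  then have "t\<^sup>2 \<le> 1 / real N" using N by (simp add: power_mult_distrib field_simps)
  moreover have "(tanh t)\<^sup>2 \<le> t\<^sup>2" using \<open>t \<ge> 0\<close> tanh_le_self by (intro power_mono) auto
  ultimately have tN: "(tanh t)\<^sup>2 \<le> 1 / real N" by simp
  have cosh: "(cosh t)\<^sup>2 * y \<le> 1" if "y \<le> 1 - 1 / real N" for y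
  proof -
    have "(cosh t)\<^sup>2 * y \<le> (cosh t)\<^sup>2 * (1 - (tanh t)\<^sup>2)"
      using that tN by (intro mult_left_mono) auto
    also have "\<dots> = (cosh t)\<^sup>2 - (sinh t)\<^sup>2"
      by (simp add: tanh_def power_divide right_diff_distrib)
    also have "\<dots> = 1" by (simp add: cosh_square_eq)
    finally show ?thesis .
  qed
  obtain P Q where PQ: "complementary P Q" "degree P \<le> n" "degree Q \<le> n"
    "\<And>y. 0 \<le> y \<Longrightarrow> (cosh t)\<^sup>2 * y \<le> 1 \<Longrightarrow> y * (cmod (poly P (complex_of_real y)))\<^sup>2 \<le> \<delta>\<^sup>2"
    using fixed_point_polynomial[OF \<delta>, of n] unfolding t_def by blast
  obtain p q g c where "cmod g = 1"
    "\<And>y. grover y p q n = (c * poly Q (complex_of_real y), g * poly P (complex_of_real y))"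
    using grover_synthesis[OF PQ(1-3)] by blast
  then show ?thesis
    using PQ(4) cosh by (intro exI[of _ p] exI[of _ q]) (auto simp: norm_mult)
qed


section \<open>Components of the walk operators\<close>

lemma ket_nth: "ket p $ q = (if q = p then 1 else 0)"
  by (simp add: ket_def axis_def)

lemma outer_ket_mult_vec: "outer x (ket p) *v z = z $ p *s x"
proof -
  have "(\<Sum>j\<in>UNIV. cnj (ket p $ j) * z $ j) = (\<Sum>j\<in>UNIV. if j = p then z $ j else 0)"
    by (intro sum.cong) (auto simp: ket_nth)
  then show ?thesis by (simp add: outer_mult_vec)
qed

lemma shift_nth: "(shift *v z) $ (u, v) = z $ (v, u)"
proof -
  have "(shift *v z) $ (u, v) = (\<Sum>a\<in>UNIV. \<Sum>b\<in>UNIV. if a = v then if b = u then z $ (a, b) else 0 else 0)"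
    unfolding shift_def sum_mult_vec outer_ket_mult_vec
    by (auto simp: ket_nth intro!: sum.cong)
  also have "\<dots> = (\<Sum>a\<in>UNIV. if a = v then \<Sum>b\<in>UNIV. if b = u then z $ (a, b) else 0 else 0)"
    by (intro sum.cong) auto
  finally show ?thesis by simp
qed

lemma query_nth:
  "(query M \<beta> *v z) $ (u, v) = (if u \<in> M then exp (\<i> * complex_of_real \<beta>) else 1) * z $ (u, v)"
  (is "_ = ?c u * _")
proof -
  have "(query M \<beta> *v z) $ (u, v) =
      (\<Sum>a\<in>UNIV. \<Sum>b\<in>UNIV. if a = u then if b = v then ?c a * z $ (a, b) else 0 else 0)"
    unfolding query_def sum_mult_vec scale_mult_vec outer_ket_mult_vec
    by (auto simp: ket_nth intro!: sum.cong)
  also have "\<dots> = (\<Sum>a\<in>UNIV. if a = u then \<Sum>b\<in>UNIV. if b = v then ?c a * z $ (a, b) else 0 else 0)"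
    by (intro sum.cong) auto
  finally show ?thesis by simp
qed

lemma coin_state_nth:
  "coin_state E u $ v = (if E u v then complex_of_real (1 / sqrt (real (deg E u))) else 0)"
  by (simp add: coin_state_def ket_nth nbrs_def)

lemma tensor_ket_mult_nth:
  "(tensor_mat (outer (ket a) (ket a)) B *v z) $ (u, v) =
    (if a = u then \<Sum>w\<in>UNIV. B $ v $ w * z $ (u, w) else 0)"
proof -
  have "(tensor_mat (outer (ket a) (ket a)) B *v z) $ (u, v) =
      (\<Sum>p\<in>UNIV. (if u = a then 1 else 0) * (if fst p = a then 1 else 0) * B $ v $ snd p * z $ p)"
    by (auto simp: matrix_vector_mult_def tensor_mat_def outer_def ket_nth intro!: sum.cong)
  also have "\<dots> = (\<Sum>b\<in>UNIV. \<Sum>w\<in>UNIV. (if u = a then 1 else 0) * (if b = a then 1 else 0) * B $ v $ w * z $ (b, w))"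
    by (simp add: UNIV_Times_UNIV[symmetric] sum.cartesian_product case_prod_beta del: UNIV_Times_UNIV)
  also have "\<dots> = (\<Sum>b\<in>UNIV. if b = a then if a = u then \<Sum>w\<in>UNIV. B $ v $ w * z $ (b, w) else 0 else 0)"
    by (intro sum.cong) auto
  finally show ?thesis by simp
qed

lemma coin_nth:
  "(coin E \<alpha> *v z) $ (u, v) =
    (if E u v then (1 - exp (- (\<i> * complex_of_real \<alpha>))) * (\<Sum>w\<in>nbrs E u. z $ (u, w)) / of_nat (deg E u)
     else 0) - z $ (u, v)"
proof -
  define c where "c = 1 - exp (- (\<i> * complex_of_real \<alpha>))"
  define s where "s = complex_of_real (1 / sqrt (real (deg E u)))"
  have s: "s * s = 1 / of_nat (deg E u)" "cnj s = s"
    by (simp_all add: s_def flip: of_real_mult)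
  have cs: "coin_state E u $ w = (if E u w then s else 0)" for w
    by (simp add: coin_state_nth s_def)
  have "(coin E \<alpha> *v z) $ (u, v) =
      (\<Sum>w\<in>UNIV. (c *\<^sub>m outer (coin_state E u) (coin_state E u) - mat 1) $ v $ w * z $ (u, w))"
    unfolding coin_def sum_mult_vec c_def by (simp add: tensor_ket_mult_nth)
  also have "\<dots> = (\<Sum>w\<in>UNIV. (if E u w then (if E u v then c * (s * s) else 0) * z $ (u, w) else 0)
      - (if w = v then z $ (u, w) else 0))"
    by (intro sum.cong refl)
      (auto simp: scale_mat_def outer_def cs s(2) mat_def algebra_simps)
  also have "\<dots> = (if E u v then c * (s * s) else 0) * (\<Sum>w\<in>nbrs E u. z $ (u, w)) - z $ (u, v)"
    by (simp add: sum_subtractf sum_distrib_left nbrs_def sum.If_cases)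
  finally show ?thesis unfolding s c_def by simp
qed

text \<open>The shift acts last, so the amplitude at \<open>(u, v)\<close> comes from position
  \<open>v\<close>; marking and averaging therefore concern \<open>v\<close>.\<close>

lemma step_nth:
  "(step E M \<alpha> \<beta> *v z) $ (u, v) = (if v \<in> M then exp (\<i> * complex_of_real \<beta>) else 1) *
    ((if E v u then (1 - exp (- (\<i> * complex_of_real \<alpha>))) * (\<Sum>w\<in>nbrs E v. z $ (v, w)) / of_nat (deg E v)
     else 0) - z $ (v, u))"
  unfolding step_def matrix_vector_mul_assoc[symmetric] shift_nth coin_nth query_nth
  by (simp add: sum_distrib_left algebra_simps)

lemma init_state_nth:
  "init_state E Vl Vr $ (u, v) =
    (if E u v then complex_of_real (1 / sqrt (2 * real (card Vl) * real (card Vr))) else 0)"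
proof -
  have "(\<Sum>a\<in>UNIV. tensor_vec (ket a) (\<Sum>w\<in>nbrs E a. ket w)) $ (u, v) =
      (\<Sum>a\<in>UNIV. if a = u then if E a v then 1 else 0 else 0)"
    by (simp add: tensor_vec_def ket_nth nbrs_def if_distrib[of "\<lambda>c. c * _"] cong: if_cong)
  also have "\<dots> = (if E u v then 1 else 0)" by simp
  finally show ?thesis by (simp add: init_state_def)
qed

section \<open>The walk keeps position and coin in a product state\<close>

definition amp :: "'v set \<Rightarrow> complex \<times> complex \<Rightarrow> 'v \<Rightarrow> complex" where
  "amp M z u = (if u \<in> M then fst z else snd z)"

definition unmarked :: "'v set \<Rightarrow> 'v set \<Rightarrow> real" where
  "unmarked M S = real (card (S - M)) / real (card S)"

text \<open>The two components of \<open>side\<close> are the state of one side of the graph at time \<open>k\<close> when it currently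
  carries the position and when it currently carries the coin.\<close>

primrec side :: "real \<Rightarrow> (nat \<Rightarrow> real) \<Rightarrow> (nat \<Rightarrow> real) \<Rightarrow> nat \<Rightarrow>
    (complex \<times> complex) \<times> (complex \<times> complex)" where
  "side y \<alpha> \<beta> 0 = ((1, 1), (1, 1))"
| "side y \<alpha> \<beta> (Suc k) =
    (diffuse y (\<alpha> (Suc k)) (snd (side y \<alpha> \<beta> k)), mark (\<beta> (Suc k)) (fst (side y \<alpha> \<beta> k)))"

lemma card_marked:
  assumes "finite S" "S \<noteq> {}"
  shows "real (card (S - M)) = real (card S) * unmarked M S"
    and "real (card (S \<inter> M)) = real (card S) * (1 - unmarked M S)"
proof -
  show unm: "real (card (S - M)) = real (card S) * unmarked M S"
    using assms by (simp add: unmarked_def)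
  have "card S = card (S \<inter> M) + card (S - M)"
    using assms(1) by (metis card_Un_disjoint Int_Diff_Un Int_Diff_disjoint finite_Diff finite_Int)
  then have "real (card S) = real (card (S \<inter> M)) + real (card (S - M))" by simp
  then show "real (card (S \<inter> M)) = real (card S) * (1 - unmarked M S)"
    unfolding unm by (simp add: right_diff_distrib)
qed

lemma sum_split_marked:
  fixes f :: "complex \<Rightarrow> 'a :: comm_semiring_1"
  assumes "finite S"
  shows "(\<Sum>w\<in>S. f (amp M z w)) =
    of_nat (card (S \<inter> M)) * f (fst z) + of_nat (card (S - M)) * f (snd z)"
proof -
  have "(\<Sum>w\<in>S. f (amp M z w)) = (\<Sum>w\<in>S. if w \<in> M then f (fst z) else f (snd z))"
    by (intro sum.cong) (auto simp: amp_def)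
  then show ?thesis using assms by (simp add: sum.If_cases Diff_eq Collect_mem_eq)
qed

text \<open>The weighted mean inside \<open>diffuse\<close> is the plain average of the amplitudes
  over \<open>S\<close>.\<close>

lemma diffuse_amp:
  assumes "finite S" "S \<noteq> {}"
  shows "amp M (diffuse (unmarked M S) \<alpha> z) u = amp M z u -
    (1 - exp (- (\<i> * complex_of_real \<alpha>))) * (\<Sum>w\<in>S. amp M z w) / of_nat (card S)"
proof -
  have "(\<Sum>w\<in>S. amp M z w) = complex_of_real (real (card (S \<inter> M))) * fst z +
      complex_of_real (real (card (S - M))) * snd z"
    using sum_split_marked[OF assms(1), of "\<lambda>x. x" M z] by simp
  also have "\<dots> = of_nat (card S) * (complex_of_real (1 - unmarked M S) * fst z +
      complex_of_real (unmarked M S) * snd z)"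
    unfolding card_marked[OF assms] by (simp add: algebra_simps)
  finally show ?thesis
    using assms by (simp add: diffuse_def amp_def Let_def)
qed

lemma mark_amp:
  "amp M (mark \<beta> z) u = (if u \<in> M then exp (\<i> * complex_of_real \<beta>) else 1) * amp M z u"
  by (simp add: amp_def mark_def)

text \<open>One step marks the position factor, which becomes the coin, and diffuses the coin
  factor, which becomes the position. On edges the coin operator is minus the diffusion, whence the
  sign \<open>(- 1) ^ k\<close>.\<close>

lemma walk_state_nth:
  fixes E :: "'v::finite \<Rightarrow> 'v \<Rightarrow> bool"
    and M :: "'v set" and \<alpha> \<beta> :: "nat \<Rightarrow> real" and k :: nat
  assumes bip: "complete_bipartite E Vl Vr" and ne: "Vl \<noteq> {}" "Vr \<noteq> {}"
  defines "l \<equiv> side (unmarked M Vl) \<alpha> \<beta>" and "r \<equiv> side (unmarked M Vr) \<alpha> \<beta>"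
  shows "walk_state E Vl Vr M \<alpha> \<beta> k $ (u, v) =
    (- 1) ^ k * complex_of_real (1 / sqrt (2 * real (card Vl) * real (card Vr))) *
    (if u \<in> Vl \<and> v \<in> Vr then amp M (fst (l k)) u * amp M (snd (r k)) v
     else if u \<in> Vr \<and> v \<in> Vl then amp M (fst (r k)) u * amp M (snd (l k)) v else 0)"
proof (induction k arbitrary: u v)
  case 0
  then show ?case
    using bip by (auto simp: init_state_nth complete_bipartite_def l_def r_def amp_def)
next
  case (Suc k)
  have E: "E u v \<longleftrightarrow> (u \<in> Vl \<and> v \<in> Vr) \<or> (u \<in> Vr \<and> v \<in> Vl)" for u v
    using bip by (auto simp: complete_bipartite_def)
  have disj: "Vl \<inter> Vr = {}"
    using bip by (auto simp: complete_bipartite_def)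
  define K where "K = (- 1) ^ k * complex_of_real (1 / sqrt (2 * real (card Vl) * real (card Vr)))"
  let ?c = "1 - exp (- (\<i> * complex_of_real (\<alpha> (Suc k))))"
  let ?q = "if v \<in> M then exp (\<i> * complex_of_real (\<beta> (Suc k))) else 1"
  let ?z = "walk_state E Vl Vr M \<alpha> \<beta> k"
  \<comment> \<open>Serves both edge directions: \<open>x\<close> is the old position factor, on the
    side of \<open>v\<close>, and \<open>y\<close> the old coin factor, on the side \<open>S\<close>
    of \<open>u\<close>.\<close>
  have prod: "?q * (?c * (\<Sum>w\<in>S. K * (amp M x v * amp M y w)) / of_nat (card S) -
        K * (amp M x v * amp M y u)) =
      - K * (amp M (diffuse (unmarked M S) (\<alpha> (Suc k)) y) u * amp M (mark (\<beta> (Suc k)) x) v)"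
    if "S \<noteq> {}" for S x y
  proof -
    have "q * (c * (K * (a * s)) / N - K * (a * b)) = - K * ((b - c * s / N) * (q * a))"
      for q c a s N b :: complex by (simp add: algebra_simps)
    then show ?thesis
      unfolding mark_amp diffuse_amp[OF finite that] sum_distrib_left[symmetric] by blast
  qed
  have lk: "l (Suc k) = (diffuse (unmarked M Vl) (\<alpha> (Suc k)) (snd (l k)), mark (\<beta> (Suc k)) (fst (l k)))"
    and rk: "r (Suc k) = (diffuse (unmarked M Vr) (\<alpha> (Suc k)) (snd (r k)), mark (\<beta> (Suc k)) (fst (r k)))"
    by (simp_all add: l_def r_def)
  consider "u \<in> Vl" "v \<in> Vr" | "u \<in> Vr" "v \<in> Vl" | "\<not> E v u" "\<not> E u v" using E by blast
  then show ?case
  proof cases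
    case 1
    then have nb: "nbrs E v = Vl" and not: "v \<notin> Vl" "u \<notin> Vr" using disj by (auto simp: nbrs_def E)
    have "(\<Sum>w\<in>Vl. ?z $ (v, w)) = (\<Sum>w\<in>Vl. K * (amp M (fst (r k)) v * amp M (snd (l k)) w))"
      using 1 not by (intro sum.cong) (simp_all add: Suc.IH K_def)
    moreover have "?z $ (v, u) = K * (amp M (fst (r k)) v * amp M (snd (l k)) u)"
      using 1 not by (simp add: Suc.IH K_def)
    ultimately have "walk_state E Vl Vr M \<alpha> \<beta> (Suc k) $ (u, v) =
        - K * (amp M (fst (l (Suc k))) u * amp M (snd (r (Suc k))) v)"
      using 1 prod[OF ne(1), of "fst (r k)" "snd (l k)"]
      by (simp only: walk_state.simps step_nth nb deg_def lk rk fst_conv snd_conv E simp_thms if_True)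
    then show ?thesis using 1 by (simp add: K_def)
  next
    case 2
    then have nb: "nbrs E v = Vr" and not: "v \<notin> Vr" "u \<notin> Vl" using disj by (auto simp: nbrs_def E)
    have "(\<Sum>w\<in>Vr. ?z $ (v, w)) = (\<Sum>w\<in>Vr. K * (amp M (fst (l k)) v * amp M (snd (r k)) w))"
      using 2 not by (intro sum.cong) (simp_all add: Suc.IH K_def)
    moreover have "?z $ (v, u) = K * (amp M (fst (l k)) v * amp M (snd (r k)) u)"
      using 2 not by (simp add: Suc.IH K_def)
    ultimately have "walk_state E Vl Vr M \<alpha> \<beta> (Suc k) $ (u, v) =
        - K * (amp M (fst (r (Suc k))) u * amp M (snd (l (Suc k))) v)"
      using 2 prod[OF ne(2), of "fst (l k)" "snd (r k)"]
      by (simp only: walk_state.simps step_nth nb deg_def lk rk fst_conv snd_conv E simp_thms if_True)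
    then show ?thesis using 2 not by (simp add: K_def)
  next
    case 3
    \<comment> \<open>On non-edges the coin acts as minus the identity, so zero amplitudes stay
      zero.\<close>
    then have "?z $ (v, u) = 0" by (auto simp: Suc.IH E)
    then have "walk_state E Vl Vr M \<alpha> \<beta> (Suc k) $ (u, v) = 0"
      using 3(1) by (simp add: step_nth)
    moreover have "\<not> (u \<in> Vl \<and> v \<in> Vr)" "\<not> (u \<in> Vr \<and> v \<in> Vl)" using 3 E by blast+
    ultimately show ?thesis by (simp only: if_False mult_zero_right)
  qed
qed

section \<open>The success probability in terms of the two sides\<close>

lemma side_norm:
  "y * (cmod (snd (fst (side y \<alpha> \<beta> k))))\<^sup>2 + (1 - y) * (cmod (fst (fst (side y \<alpha> \<beta> k))))\<^sup>2 = 1"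
  "y * (cmod (snd (snd (side y \<alpha> \<beta> k))))\<^sup>2 + (1 - y) * (cmod (fst (snd (side y \<alpha> \<beta> k))))\<^sup>2 = 1"
  by (induction k) (simp_all add: diffuse_norm mark_def norm_mult)

lemma sum_amp_power2:
  assumes "finite S" "S \<noteq> {}"
  shows "(\<Sum>w\<in>S. (cmod (amp M z w))\<^sup>2) =
      real (card S) * (unmarked M S * (cmod (snd z))\<^sup>2 + (1 - unmarked M S) * (cmod (fst z))\<^sup>2)"
    and "(\<Sum>w\<in>S - M. (cmod (amp M z w))\<^sup>2) = real (card S) * (unmarked M S * (cmod (snd z))\<^sup>2)"
proof -
  show "(\<Sum>w\<in>S. (cmod (amp M z w))\<^sup>2) =
      real (card S) * (unmarked M S * (cmod (snd z))\<^sup>2 + (1 - unmarked M S) * (cmod (fst z))\<^sup>2)"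
    using sum_split_marked[OF assms(1), of "\<lambda>x. (cmod x)\<^sup>2" M z] card_marked[OF assms, of M]
    by (simp add: algebra_simps)
  have "(\<Sum>w\<in>S - M. (cmod (amp M z w))\<^sup>2) = real (card (S - M)) * (cmod (snd z))\<^sup>2"
    by (simp add: amp_def)
  then show "(\<Sum>w\<in>S - M. (cmod (amp M z w))\<^sup>2) = real (card S) * (unmarked M S * (cmod (snd z))\<^sup>2)"
    by (simp add: card_marked(1)[OF assms])
qed

text \<open>Failure means that both registers are unmarked. The two edge directions have disjoint
  supports, weight 1/2 each, and product amplitudes, so the failure mass factorises in each; the
  total mass is 1.\<close>

lemma success_prob_eq:
  fixes E :: "'v::finite \<Rightarrow> 'v \<Rightarrow> bool"
    and M :: "'v set" and \<alpha> \<beta> :: "nat \<Rightarrow> real" and k :: nat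
  assumes bip: "complete_bipartite E Vl Vr" and ne: "Vl \<noteq> {}" "Vr \<noteq> {}"
  defines "yl \<equiv> unmarked M Vl" and "yr \<equiv> unmarked M Vr"
  shows "success_prob E Vl Vr M \<alpha> \<beta> k = 1 -
    ((yl * (cmod (snd (fst (side yl \<alpha> \<beta> k))))\<^sup>2) * (yr * (cmod (snd (snd (side yr \<alpha> \<beta> k))))\<^sup>2) +
     (yr * (cmod (snd (fst (side yr \<alpha> \<beta> k))))\<^sup>2) * (yl * (cmod (snd (snd (side yl \<alpha> \<beta> k))))\<^sup>2)) / 2"
proof -
  let ?l = "side yl \<alpha> \<beta> k" and ?r = "side yr \<alpha> \<beta> k"
  define f where "f p = (cmod (walk_state E Vl Vr M \<alpha> \<beta> k $ p))\<^sup>2" for p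
  define K where "K = 1 / (2 * real (card Vl) * real (card Vr))"
  have disj: "Vl \<inter> Vr = {}" and un: "Vl \<union> Vr = UNIV"
    using bip by (auto simp: complete_bipartite_def)
  have pos: "real (card Vl) > 0" "real (card Vr) > 0" using ne by (auto simp: card_gt_0_iff)
  have f: "f (u, v) = K * (if u \<in> Vl \<and> v \<in> Vr then (cmod (amp M (fst ?l) u))\<^sup>2 * (cmod (amp M (snd ?r) v))\<^sup>2
     else if u \<in> Vr \<and> v \<in> Vl then (cmod (amp M (fst ?r) u))\<^sup>2 * (cmod (amp M (snd ?l) v))\<^sup>2 else 0)" for u v
    using pos by (simp add: f_def walk_state_nth[OF bip ne] yl_def yr_def norm_mult norm_power
        norm_divide power_mult_distrib power_divide K_def)
  \<comment> \<open>\<open>T = UNIV\<close> will give the total mass and \<open>T = - M\<close> the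
    failure probability.\<close>
  have sum: "sum f (T \<times> T) = K *
      ((\<Sum>u\<in>Vl \<inter> T. (cmod (amp M (fst ?l) u))\<^sup>2) * (\<Sum>v\<in>Vr \<inter> T. (cmod (amp M (snd ?r) v))\<^sup>2) +
       (\<Sum>u\<in>Vr \<inter> T. (cmod (amp M (fst ?r) u))\<^sup>2) * (\<Sum>v\<in>Vl \<inter> T. (cmod (amp M (snd ?l) v))\<^sup>2))" for T
  proof -
    have pull: "(\<Sum>u\<in>A. \<Sum>v\<in>B. K * (p u * q v)) = K * (sum p A * sum q B)"
      for p q :: "'v \<Rightarrow> real" and A B by (simp only: sum_product) (simp add: sum_distrib_left)
    have "sum f (T \<times> T) = sum f ((Vl \<inter> T) \<times> (Vr \<inter> T) \<union> (Vr \<inter> T) \<times> (Vl \<inter> T))"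
    proof (rule sum.mono_neutral_right)
      show "\<forall>p\<in>T \<times> T - ((Vl \<inter> T) \<times> (Vr \<inter> T) \<union> (Vr \<inter> T) \<times> (Vl \<inter> T)). f p = 0"
        by (auto simp: f split: if_splits)
    qed auto
    also have "\<dots> = sum f ((Vl \<inter> T) \<times> (Vr \<inter> T)) + sum f ((Vr \<inter> T) \<times> (Vl \<inter> T))"
      using disj by (intro sum.union_disjoint) auto
    also have "sum f ((Vl \<inter> T) \<times> (Vr \<inter> T)) = (\<Sum>u\<in>Vl \<inter> T. \<Sum>v\<in>Vr \<inter> T.
        K * ((cmod (amp M (fst ?l) u))\<^sup>2 * (cmod (amp M (snd ?r) v))\<^sup>2))"
      unfolding sum.cartesian_product by (intro sum.cong) (auto simp: f)
    also have "sum f ((Vr \<inter> T) \<times> (Vl \<inter> T)) = (\<Sum>u\<in>Vr \<inter> T. \<Sum>v\<in>Vl \<inter> T.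
        K * ((cmod (amp M (fst ?r) u))\<^sup>2 * (cmod (amp M (snd ?l) v))\<^sup>2))"
      unfolding sum.cartesian_product using disj by (intro sum.cong) (auto simp: f)
    finally show ?thesis by (simp only: pull distrib_left)
  qed
  have "1 / (2 * L * R) * (L * a * (R * b) + R * c * (L * d)) = (a * b + c * d) / 2"
    if "L > 0" "R > 0" for L R a b c d :: real
    using that by (simp add: field_simps)
  note K = this[OF pos, folded K_def]
  have "sum f (UNIV \<times> UNIV) = 1"
    unfolding sum Int_UNIV_right sum_amp_power2(1)[OF finite ne(1)] sum_amp_power2(1)[OF finite ne(2)]
      yl_def[symmetric] yr_def[symmetric] side_norm
    using pos ne by (simp add: K_def field_simps)
  moreover have "sum f ((- M) \<times> (- M)) =
    ((yl * (cmod (snd (fst ?l)))\<^sup>2) * (yr * (cmod (snd (snd ?r)))\<^sup>2) +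
     (yr * (cmod (snd (fst ?r)))\<^sup>2) * (yl * (cmod (snd (snd ?l)))\<^sup>2)) / 2"
    unfolding sum Diff_eq[symmetric] sum_amp_power2(2)[OF finite ne(1)] sum_amp_power2(2)[OF finite ne(2)]
      yl_def[symmetric] yr_def[symmetric]
    by (rule K)
  moreover have "success_prob E Vl Vr M \<alpha> \<beta> k = sum f (UNIV \<times> UNIV - (- M) \<times> (- M))"
    unfolding success_prob_def f_def by (intro sum.cong) auto
  ultimately show ?thesis by (simp add: sum_diff)
qed

text \<open>Diffusing the uniform state only changes its global phase, which \<open>\<alpha> 1 = 0\<close> makes trivial.\<close>

lemma side_grover:
  assumes "\<alpha> 1 = 0"
  shows "fst (side y \<alpha> \<beta> (2 * n)) = grover y (\<lambda>j. \<alpha> (2 * j + 2)) (\<lambda>j. \<beta> (2 * j + 1)) n"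
    and "fst (side y \<alpha> \<beta> (2 * n + 1)) = grover y (\<lambda>j. \<alpha> (2 * j + 3)) (\<lambda>j. \<beta> (2 * j + 2)) n"
proof -
  show "fst (side y \<alpha> \<beta> (2 * n)) = grover y (\<lambda>j. \<alpha> (2 * j + 2)) (\<lambda>j. \<beta> (2 * j + 1)) n"
    by (induction n) simp_all
  show "fst (side y \<alpha> \<beta> (2 * n + 1)) = grover y (\<lambda>j. \<alpha> (2 * j + 3)) (\<lambda>j. \<beta> (2 * j + 2)) n"
    by (induction n) (use assms in \<open>simp_all add: diffuse_def numeral_3_eq_3\<close>)
qed

text \<open>Marking leaves the unmarked amplitude alone, so the coin factor lags one step behind the
  position factor.\<close>

lemma snd_snd_side_Suc: "snd (snd (side y \<alpha> \<beta> (Suc k))) = snd (fst (side y \<alpha> \<beta> k))"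
  by (simp add: mark_def)


theorem theorem1:
  fixes E :: "'v::finite \<Rightarrow> 'v \<Rightarrow> bool" and Vl Vr :: "'v set" and \<epsilon> :: real and h :: nat
  assumes "complete_bipartite E Vl Vr" and "card Vl \<ge> 1" and "card Vr \<ge> 1"
    and "0 < \<epsilon>" and "\<epsilon> \<le> 1" and "h > 0"
    and "real h \<ge> ln (2 / sqrt \<epsilon>) * max (sqrt (real (card Vl))) (sqrt (real (card Vr))) + 1"
  shows "\<exists>\<alpha> \<beta> :: nat \<Rightarrow> real. \<forall>M. M \<noteq> {} \<and> M \<subseteq> Vl \<union> Vr \<longrightarrow>
           success_prob E Vl Vr M \<alpha> \<beta> h \<ge> 1 - \<epsilon>"
proof -
  define \<delta> where "\<delta> = sqrt \<epsilon>"
  \<comment> \<open>The larger side serves for both, so the phases do not depend on which side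
    carries marked vertices.\<close>
  define N where "N = max (card Vl) (card Vr)"
  define n1 where "n1 = h div 2"
  define n2 where "n2 = (h - 1) div 2"
  have \<delta>: "0 < \<delta>" "\<delta> \<le> 1" "\<delta>\<^sup>2 = \<epsilon>" using assms(4,5) by (simp_all add: \<delta>_def)
  have N1: "N \<ge> 1" using assms(2) by (simp add: N_def)
  have "max (sqrt (real (card Vl))) (sqrt (real (card Vr))) = sqrt (real N)"
    by (auto simp: N_def max_def)
  then have h: "ln (2 / \<delta>) * sqrt (real N) \<le> real h - 1"
    using assms(7) by (simp add: \<delta>_def)
  \<comment> \<open>For even \<open>h\<close> the second bound is an equality: the factor that lags
    behind uses up the extra 1 in the assumption on \<open>h\<close>.\<close>
  have n: "real h - 1 \<le> real (2 * n1 + 1)" "real h - 1 \<le> real (2 * n2 + 1)"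
    using assms(6) unfolding n1_def n2_def by linarith+
  obtain p1 q1 where 1: "\<And>y. 0 \<le> y \<Longrightarrow> y \<le> 1 - 1 / real N \<Longrightarrow>
      y * (cmod (snd (grover y p1 q1 n1)))\<^sup>2 \<le> \<epsilon>"
    using fixed_point_phases[OF \<delta>(1,2) N1 order_trans[OF h n(1)]] unfolding \<delta>(3) by blast
  obtain p2 q2 where 2: "\<And>y. 0 \<le> y \<Longrightarrow> y \<le> 1 - 1 / real N \<Longrightarrow>
      y * (cmod (snd (grover y p2 q2 n2)))\<^sup>2 \<le> \<epsilon>"
    using fixed_point_phases[OF \<delta>(1,2) N1 order_trans[OF h n(2)]] unfolding \<delta>(3) by blast
  \<comment> \<open>Even \<open>\<alpha>\<close> and odd \<open>\<beta>\<close> carry the first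
    sequence, odd \<open>\<alpha>\<close> from 3 on and even \<open>\<beta>\<close> the second,
    shifted as in \<open>side_grover\<close>; that lemma also asks for the value 0 at 1.\<close>
  define \<alpha> where "\<alpha> k = (if k = 1 then 0 else if even k then p1 (k div 2 - 1) else p2 (k div 2 - 1))" for k
  define \<beta> where "\<beta> k = (if odd k then q1 (k div 2) else q2 (k div 2 - 1))" for k
  have g1: "fst (side y \<alpha> \<beta> (2 * n)) = grover y p1 q1 n" for y n
    by (subst side_grover(1)) (auto simp: \<alpha>_def \<beta>_def intro!: grover_cong)
  have g2: "fst (side y \<alpha> \<beta> (2 * n + 1)) = grover y p2 q2 n" for y n
    by (subst side_grover(2)) (auto simp: \<alpha>_def \<beta>_def intro!: grover_cong)
  \<comment> \<open>The times \<open>h\<close> and \<open>h - 1\<close> have opposite parity, so one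
    of the two amplitudes is governed by each sequence.\<close>
  have fails: "y * (cmod (snd (fst (side y \<alpha> \<beta> h))))\<^sup>2 \<le> \<epsilon> \<and> y * (cmod (snd (snd (side y \<alpha> \<beta> h))))\<^sup>2 \<le> \<epsilon>"
    if y: "0 \<le> y" "y \<le> 1 - 1 / real N" for y
  proof -
    have hs: "snd (snd (side y \<alpha> \<beta> h)) = snd (fst (side y \<alpha> \<beta> (h - 1)))"
      using snd_snd_side_Suc[of y \<alpha> \<beta> "h - 1"] assms(6) by simp
    show ?thesis
    proof (cases "even h")
      case True
      then have "h = 2 * n1" "h - 1 = 2 * n2 + 1"
        using assms(6) by (auto simp: n1_def n2_def elim!: evenE)
      then show ?thesis unfolding hs using 1[OF y] 2[OF y] g1[of y n1] g2[of y n2] by simp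
    next
      case False
      then have "h = 2 * n2 + 1" "h - 1 = 2 * n1"
        by (auto simp: n1_def n2_def elim!: oddE)
      then show ?thesis unfolding hs using 1[OF y] 2[OF y] g1[of y n1] g2[of y n2] by simp
    qed
  qed
  have ne: "Vl \<noteq> {}" "Vr \<noteq> {}" using assms(2,3) by force+
  show ?thesis
  proof (rule exI[of _ \<alpha>], rule exI[of _ \<beta>], intro allI impI)
    fix M assume M: "M \<noteq> {} \<and> M \<subseteq> Vl \<union> Vr"
    define f g where "f S = unmarked M S * (cmod (snd (fst (side (unmarked M S) \<alpha> \<beta> h))))\<^sup>2"
      and "g S = unmarked M S * (cmod (snd (snd (side (unmarked M S) \<alpha> \<beta> h))))\<^sup>2" for S
    have y01: "0 \<le> unmarked M S" "unmarked M S \<le> 1" for S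
      using card_mono[of S "S - M"] by (auto simp: unmarked_def divide_le_eq_1)
    have nonneg: "0 \<le> f S" "0 \<le> g S" for S using y01 by (simp_all add: f_def g_def)
    \<comment> \<open>The only bound available on a side without marked vertices.\<close>
    have le1: "f S \<le> 1" "g S \<le> 1" for S
      using side_norm[of "unmarked M S" \<alpha> \<beta> h] y01[of S]
      unfolding f_def g_def by (smt (verit) mult_nonneg_nonneg zero_le_power2)+
    have small: "f S \<le> \<epsilon> \<and> g S \<le> \<epsilon>" if "S \<inter> M \<noteq> {}" "card S \<le> N" for S
    proof -
      have S: "S \<noteq> {}" using that by auto
      then have "card S > 0" by (simp add: card_gt_0_iff)
      have "card (S \<inter> M) \<ge> 1" using that(1) by (simp add: card_gt_0_iff Suc_le_eq)
      then have "1 \<le> real (card S) * (1 - unmarked M S)"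
        unfolding card_marked(2)[OF finite S, symmetric] by simp
      also have "\<dots> \<le> real N * (1 - unmarked M S)"
        using that(2) y01[of S] by (intro mult_right_mono) auto
      finally have "unmarked M S \<le> 1 - 1 / real N" using N1 by (simp add: field_simps)
      then show ?thesis unfolding f_def g_def using fails y01 by blast
    qed
    \<comment> \<open>Each product mixes both sides, so one side with a marked vertex suffices: its
      factor is at most \<epsilon>, the other at most 1.\<close>
    have "f Vl * g Vr + f Vr * g Vl \<le> 2 * \<epsilon>"
    proof (cases "Vl \<inter> M = {}")
      case False
      then have "f Vl \<le> \<epsilon>" "g Vl \<le> \<epsilon>" using small[of Vl] by (auto simp: N_def)
      then have "f Vl * g Vr \<le> \<epsilon> * 1 \<and> f Vr * g Vl \<le> 1 * \<epsilon>"
        using nonneg le1 assms(4) by (intro conjI mult_mono) simp_all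
      then show ?thesis by simp
    next
      case True
      then have "Vr \<inter> M \<noteq> {}" using M by auto
      then have "f Vr \<le> \<epsilon>" "g Vr \<le> \<epsilon>" using small[of Vr] by (auto simp: N_def)
      then have "f Vl * g Vr \<le> 1 * \<epsilon> \<and> f Vr * g Vl \<le> \<epsilon> * 1"
        using nonneg le1 assms(4) by (intro conjI mult_mono) simp_all
      then show ?thesis by simp
    qed
    then show "success_prob E Vl Vr M \<alpha> \<beta> h \<ge> 1 - \<epsilon>"
      unfolding success_prob_eq[OF assms(1) ne] f_def g_def by simp
  qed
qed

end
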